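(* Let $(\mathbb{P},\leq)$ be a poset and let $\Theta\subseteq\mathcal{P}(\mathbb{P})$ be an up-set (with respect to refinement). If $\Theta$ is Picado-Pultr admissible, then $\Theta$ is Wallman admissible.
   Context: For $R,S\subseteq\mathbb{P}$, $R\leq S$ ($R$ refines $S$) means $\forall r\in R\ \exists s\in S\ (r\leq s)$; $\Theta\subseteq\mathcal{P}(\mathbb{P})$ is an up-set if $C\in\Theta$ and $C\leq D\subseteq\mathbb{P}$ imply $D\in\Theta$. A subset $C\subseteq\mathbb{P}$ is a $\leq$-cover if for all $p,q\in\mathbb{P}$: $p\leq q$ if and only if every $r\in\mathbb{P}$ with $r\leq p$ and $r\leq c$ for some $c\in C$ satisfies $r\leq q$. $\mathcal{C}_\leq(\mathbb{P})$ is the collection of all $\leq$-covers. $\Theta$ is Picado-Pultr admissible if for all $p,q\in\mathbb{P}$: $p\leq q\Leftrightarrow\forall C\in\Theta\ ((C\setminus\{p\})\cup\{q\}\in\mathcal{C}_\leq(\mathbb{P}))$. $\Theta$ is Wallman admissible if for all $p,q\in\mathbb{P}$: $p\leq q\Leftrightarrow\forall C\in\Theta\ ((C\setminus\{p\})\cup\{q\}\in\Theta)$. *)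

theory Defs
  imports Main
begin

(* A poset is a carrier P with an order relation r such that partial_order_on P r;
   (p, q) \<in> r means p \<le> q. An explicit carrier is used so that the empty poset
   is included. *)

definition refines :: "'a rel \<Rightarrow> 'a set \<Rightarrow> 'a set \<Rightarrow> bool" where
  "refines r R S \<longleftrightarrow> (\<forall>x\<in>R. \<exists>s\<in>S. (x, s) \<in> r)"

definition up_set :: "'a set \<Rightarrow> 'a rel \<Rightarrow> 'a set set \<Rightarrow> bool" where
  "up_set P r \<Theta> \<longleftrightarrow> (\<forall>C D. C \<in> \<Theta> \<longrightarrow> D \<subseteq> P \<longrightarrow> refines r C D \<longrightarrow> D \<in> \<Theta>)"

definition order_covers :: "'a set \<Rightarrow> 'a rel \<Rightarrow> 'a set set" where
  "order_covers P r = {C. C \<subseteq> P \<and>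
     (\<forall>p\<in>P. \<forall>q\<in>P. (p, q) \<in> r \<longleftrightarrow>
        (\<forall>x\<in>P. (x, p) \<in> r \<and> (\<exists>c\<in>C. (x, c) \<in> r) \<longrightarrow> (x, q) \<in> r))}"

definition picado_pultr_admissible :: "'a set \<Rightarrow> 'a rel \<Rightarrow> 'a set set \<Rightarrow> bool" where
  "picado_pultr_admissible P r \<Theta> \<longleftrightarrow>
     (\<forall>p\<in>P. \<forall>q\<in>P. (p, q) \<in> r \<longleftrightarrow> (\<forall>C\<in>\<Theta>. (C - {p}) \<union> {q} \<in> order_covers P r))"

definition wallman_admissible :: "'a set \<Rightarrow> 'a rel \<Rightarrow> 'a set set \<Rightarrow> bool" where
  "wallman_admissible P r \<Theta> \<longleftrightarrow>
     (\<forall>p\<in>P. \<forall>q\<in>P. (p, q) \<in> r \<longleftrightarrow> (\<forall>C\<in>\<Theta>. (C - {p}) \<union> {q} \<in> \<Theta>))"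

end

theory Submission imports Defs begin

text \<open>
  Put \<open>D = (C - {p}) \<union> {q}\<close> for \<open>C \<in> \<Theta>\<close>. If \<open>p \<le> q\<close>, then \<open>C\<close> refines \<open>D\<close>, since \<open>p\<close> lies below
  \<open>q\<close> and every other element of \<open>C\<close> survives in \<open>D\<close>; hence \<open>D \<in> \<Theta>\<close> because \<open>\<Theta>\<close> is an up-set.

  Conversely, if every such \<open>D\<close> lies in \<open>\<Theta>\<close>, then Picado-Pultr admissibility yields \<open>p \<le> q\<close> as
  soon as each \<open>D\<close> is known to be an order cover. Picado-Pultr admissibility itself provides this:
  applied to the reflexive pair \<open>q \<le> q\<close> and the member \<open>D\<close> of \<open>\<Theta>\<close>, it says that
  \<open>(D - {q}) \<union> {q}\<close> is a cover, and this set is \<open>D\<close> because \<open>q \<in> D\<close>.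
\<close>

lemma refines_replace:
  assumes "refl_on P r" and "C \<subseteq> P" and "(p, q) \<in> r"
  shows "refines r C ((C - {p}) \<union> {q})"
  unfolding refines_def using assms by (auto dest: refl_onD)

text \<open>
  Replacing an element of \<open>D\<close> by itself leaves \<open>D\<close> unchanged. Some element must be present,
  because admissibility constrains a member of \<open>\<Theta>\<close> only after a point has been put into it.
\<close>
lemma picado_pultr_admissible_imp_order_cover:
  assumes "picado_pultr_admissible P r \<Theta>" and "refl_on P r"
    and "D \<in> \<Theta>" and "q \<in> D" and "q \<in> P"
  shows "D \<in> order_covers P r"
proof -
  have "(D - {q}) \<union> {q} \<in> order_covers P r"
    using assms(1,3,5) refl_onD[OF assms(2,5)] unfolding picado_pultr_admissible_def by simp
  then show ?thesis
    using \<open>q \<in> D\<close> by (simp add: insert_absorb)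
qed

theorem corollary9p2:
  fixes P :: "'a set" and r :: "'a rel" and \<Theta> :: "'a set set"
  assumes "partial_order_on P r"
    and "\<Theta> \<subseteq> Pow P"
    and "up_set P r \<Theta>"
    and "picado_pultr_admissible P r \<Theta>"
  shows "wallman_admissible P r \<Theta>"
  unfolding wallman_admissible_def
proof (intro ballI iffI)
  fix p q C
  assume "q \<in> P" and "(p, q) \<in> r" and "C \<in> \<Theta>"
  have "refl_on P r"
    using assms(1) by (simp add: partial_order_on_def preorder_on_def)
  moreover have "C \<subseteq> P"
    using assms(2) \<open>C \<in> \<Theta>\<close> by blast
  ultimately have "refines r C ((C - {p}) \<union> {q})"
    using \<open>(p, q) \<in> r\<close> by (rule refines_replace)
  moreover have "(C - {p}) \<union> {q} \<subseteq> P"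
    using \<open>C \<subseteq> P\<close> \<open>q \<in> P\<close> by blast
  ultimately show "(C - {p}) \<union> {q} \<in> \<Theta>"
    using assms(3) \<open>C \<in> \<Theta>\<close> unfolding up_set_def by blast
next
  fix p q
  assume "p \<in> P" and "q \<in> P" and closed: "\<forall>C\<in>\<Theta>. (C - {p}) \<union> {q} \<in> \<Theta>"
  have refl: "refl_on P r"
    using assms(1) by (simp add: partial_order_on_def preorder_on_def)
  have "(C - {p}) \<union> {q} \<in> order_covers P r" if "C \<in> \<Theta>" for C
  proof (rule picado_pultr_admissible_imp_order_cover[OF assms(4) refl])
    show "(C - {p}) \<union> {q} \<in> \<Theta>"
      using closed that by (rule bspec)
    show "q \<in> (C - {p}) \<union> {q}" by simp
    show "q \<in> P" by fact
  qed
  then have "\<forall>C\<in>\<Theta>. (C - {p}) \<union> {q} \<in> order_covers P r" ..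
  then show "(p, q) \<in> r"
    using assms(4) \<open>p \<in> P\<close> \<open>q \<in> P\<close> unfolding picado_pultr_admissible_def by simp
qed

end
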